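(* Let $0<p_1=q_1<\infty$, $0<p_2=q_2<\infty$, $p_2\le p_1$, $v_1,v_2\in\mathcal W(0,\infty)$, $u_1\in{}^{\mathbf c}\Omega_{q_1}$ and $u_2\in\Omega_{q_2}$, and put $v(x)=v_1(x)^{-1}v_2(x)$. Then $$\|\mathrm I\|_{\mathrm{Cop}_{p_1,q_1}(u_1,v_1)\to\mathrm{Ces}_{p_2,q_2}(u_2,v_2)}\approx\Big\|\,\|u_1\|_{p_1,(0,\cdot)}^{-1}\,\|u_2\|_{p_2,(\cdot,\infty)}\Big\|_{p_1\to p_2,v,(0,\infty)}.$$
   Context: $\mathfrak M^+(0,\infty)$ is the set of non-negative measurable functions on $(0,\infty)$; $\mathcal W(0,\infty)$ is the set of weights (measurable functions, positive and finite a.e. on $(0,\infty)$). For $0<p\le\infty$ and measurable $A\subseteq(0,\infty)$, $\|f\|_{p,A}=(\int_A|f|^p\,dx)^{1/p}$ if $p<\infty$, $\|f\|_{\infty,A}=\operatorname{ess\,sup}_A|f|$, and $\|f\|_{p,w,A}=\|fw\|_{p,A}$. Conventions: $0/0=0$, $0\cdot(\pm\infty)=0$, $1/(\pm\infty)=0$. For $u\in\mathfrak M^+(0,\infty)$, $v\in\mathcal W(0,\infty)$ and $0<p,q\le\infty$, $\mathrm{Ces}_{p,q}(u,v)$ and $\mathrm{Cop}_{p,q}(u,v)$ are the sets of $f\in\mathfrak M^+(0,\infty)$ with finite $\|f\|_{\mathrm{Ces}_{p,q}(u,v)}=\big\|\,\|f\|_{p,v,(0,\cdot)}\big\|_{q,u,(0,\infty)}$,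 respectively $\|f\|_{\mathrm{Cop}_{p,q}(u,v)}=\big\|\,\|f\|_{p,v,(\cdot,\infty)}\big\|_{q,u,(0,\infty)}$. $\Omega_q$ is the set of $u\in\mathfrak M^+(0,\infty)$ with $0<\|u\|_{q,(t,\infty)}<\infty$ for all $t>0$; ${}^{\mathbf c}\Omega_q$ is the set of $u\in\mathfrak M^+(0,\infty)$ with $0<\|u\|_{q,(0,t)}<\infty$ for all $t>0$. $\|\mathrm I\|_{X\to Y}$ is the best constant of the embedding $X\hookrightarrow Y$: the least $c\in[0,\infty]$ with $\|f\|_Y\le c\|f\|_X$ for all $f\in X$. For $0<p,q\le\infty$, $p\to q$ denotes the number given by $\frac1{p\to q}=\frac1q-\frac1p$ if $q<p$, and $p\to q=\infty$ if $q\ge p$. $A\approx B$ means $c^{-1}B\le A\le cB$ with a constant $c>0$ depending only on $p_1,p_2$. *)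

theory Defs
  imports "HOL-Probability.Essential_Supremum"
begin

text \<open>Non-negative functions on \<open>(0,\<infinity>)\<close> are modelled as functions \<open>real \<Rightarrow> ennreal\<close> whose values
  outside \<open>{0<..}\<close> are irrelevant; exponents range over \<open>ennreal\<close>. The conventions \<open>0 \<cdot> \<infinity> = 0\<close>,
  \<open>1 / \<infinity> = 0\<close> and \<open>0 / 0 = 0\<close> are those of \<open>ennreal\<close>, where \<open>inverse 0 = top\<close>.\<close>

definition Mplus :: "(real \<Rightarrow> ennreal) set" where
  "Mplus = borel_measurable (lebesgue_on {0<..})"

definition weights :: "(real \<Rightarrow> ennreal) set" where
  "weights = {w \<in> Mplus. AE x in lebesgue_on {0<..}. 0 < w x \<and> w x < top}"

text \<open>Real powers; used only with exponents \<open>a > 0\<close>.\<close>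

definition ennpow :: "ennreal \<Rightarrow> real \<Rightarrow> ennreal" where
  "ennpow x a = (if x = top then top else ennreal (enn2real x powr a))"

definition Lnorm :: "ennreal \<Rightarrow> real set \<Rightarrow> (real \<Rightarrow> ennreal) \<Rightarrow> ennreal" where
  "Lnorm p A f =
     (if p = top then esssup (lebesgue_on A) f
      else ennpow (\<integral>\<^sup>+ x. ennpow (f x) (enn2real p) \<partial>lebesgue_on A) (1 / enn2real p))"

definition wLnorm :: "ennreal \<Rightarrow> (real \<Rightarrow> ennreal) \<Rightarrow> real set \<Rightarrow> (real \<Rightarrow> ennreal) \<Rightarrow> ennreal" where
  "wLnorm p w A f = Lnorm p A (\<lambda>x. f x * w x)"

definition Ces_norm ::
  "ennreal \<Rightarrow> ennreal \<Rightarrow> (real \<Rightarrow> ennreal) \<Rightarrow> (real \<Rightarrow> ennreal) \<Rightarrow> (real \<Rightarrow> ennreal) \<Rightarrow> ennreal" where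
  "Ces_norm p q u v f = wLnorm q u {0<..} (\<lambda>t. wLnorm p v {0<..<t} f)"

definition Cop_norm ::
  "ennreal \<Rightarrow> ennreal \<Rightarrow> (real \<Rightarrow> ennreal) \<Rightarrow> (real \<Rightarrow> ennreal) \<Rightarrow> (real \<Rightarrow> ennreal) \<Rightarrow> ennreal" where
  "Cop_norm p q u v f = wLnorm q u {0<..} (\<lambda>t. wLnorm p v {t<..} f)"

text \<open>A function space is determined by its norm functional: it consists of the \<open>f \<in> Mplus\<close> of
  finite norm.\<close>

definition space_of :: "((real \<Rightarrow> ennreal) \<Rightarrow> ennreal) \<Rightarrow> (real \<Rightarrow> ennreal) set" where
  "space_of N = {f \<in> Mplus. N f < top}"

text \<open>The best constant of the embedding of \<open>space_of N\<^sub>X\<close> into \<open>space_of N\<^sub>Y\<close>; \<open>top\<close> if there is no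
  admissible constant. As \<open>N\<^sub>X f < top\<close> on \<open>space_of N\<^sub>X\<close>, the infimum is attained if some constant
  is admissible.\<close>

definition embedding_const ::
  "((real \<Rightarrow> ennreal) \<Rightarrow> ennreal) \<Rightarrow> ((real \<Rightarrow> ennreal) \<Rightarrow> ennreal) \<Rightarrow> ennreal" where
  "embedding_const N\<^sub>X N\<^sub>Y = Inf {c. \<forall>f \<in> space_of N\<^sub>X. N\<^sub>Y f \<le> c * N\<^sub>X f}"

definition Omega :: "ennreal \<Rightarrow> (real \<Rightarrow> ennreal) set" where
  "Omega q = {u \<in> Mplus. \<forall>t>0. 0 < Lnorm q {t<..} u \<and> Lnorm q {t<..} u < top}"

definition cOmega :: "ennreal \<Rightarrow> (real \<Rightarrow> ennreal) set" where
  "cOmega q = {u \<in> Mplus. \<forall>t>0. 0 < Lnorm q {0<..<t} u \<and> Lnorm q {0<..<t} u < top}"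

definition exp_to :: "ennreal \<Rightarrow> ennreal \<Rightarrow> ennreal" where
  "exp_to p q = (if q < p then inverse (inverse q - inverse p) else top)"

end

theory Submission
  imports Defs
begin

text \<open>Since \<open>p\<^sub>i = q\<^sub>i\<close>, Tonelli's theorem turns both norms into norms of weighted Lebesgue spaces:
  the Copson norm of \<open>f\<close> is the \<open>L\<^sup>p\<close> norm, \<open>p = p\<^sub>1\<close>, of \<open>f \<cdot> v\<^sub>1 \<cdot> \<parallel>u\<^sub>1\<parallel>\<close> with the norm of \<open>u\<^sub>1\<close>
  taken over \<open>(0,x)\<close>, and the Cesaro norm is the \<open>L\<^sup>p\<close> norm, \<open>p = p\<^sub>2\<close>, of \<open>f \<cdot> v\<^sub>2 \<cdot> \<parallel>u\<^sub>2\<parallel>\<close> with the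
  norm over \<open>(x,\<infinity>)\<close>. The best constant is therefore that of the multiplication operator by the
  quotient \<open>h\<close> of the two weights from \<open>L\<^sup>P\<close> to \<open>L\<^sup>Q\<close>, which is exactly the \<open>L\<^sup>r\<close> norm of \<open>h\<close>,
  \<open>1/r = 1/Q - 1/P\<close>, by Hoelder's inequality and its sharpness. So the equivalence holds with
  constant \<open>1\<close>.\<close>

section \<open>Arithmetic of real powers on the extended non-negative reals\<close>

lemma ennpow_ennreal: "0 \<le> x \<Longrightarrow> ennpow (ennreal x) a = ennreal (x powr a)"
  by (simp add: ennpow_def)

lemma ennpow_top [simp]: "ennpow top a = top"
  by (simp add: ennpow_def)

lemma ennpow_0 [simp]: "ennpow 0 a = 0"
  by (simp add: ennpow_def)

lemma ennpow_eq_top_iff [simp]: "ennpow x a = top \<longleftrightarrow> x = top"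
  by (simp add: ennpow_def)

lemma ennpow_eq_0_iff [simp]: "ennpow x a = 0 \<longleftrightarrow> x = 0"
  by (cases x) (auto simp: ennpow_ennreal ennreal_eq_0_iff)

lemma ennpow_1 [simp]: "ennpow x 1 = x"
  by (cases x) (auto simp: ennpow_ennreal)

lemma ennpow_one [simp]: "ennpow 1 a = 1"
  using ennpow_ennreal[of 1 a] by simp

text \<open>\<open>ennpow\<close> fixes 0 and \<open>top\<close> for every real exponent, because
  \<open>0 powr a = 0\<close> and the value at \<open>top\<close> is prescribed. Hence the rule
  survives products \<open>0 * top\<close>, whatever the sign of \<open>a\<close>.\<close>

lemma ennpow_mult: "ennpow (x * y) a = ennpow x a * ennpow y a"
  by (cases x; cases y)
     (auto simp: ennpow_ennreal ennreal_mult[symmetric] powr_mult ennreal_top_mult ennreal_mult_top ennreal_eq_0_iff)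

lemma ennpow_ennpow: "ennpow (ennpow x a) b = ennpow x (a * b)"
  by (cases x) (auto simp: ennpow_ennreal powr_powr)

lemma ennpow_add: "ennpow x (a + b) = ennpow x a * ennpow x b"
  by (cases x) (auto simp: ennpow_ennreal powr_add ennreal_mult[symmetric])

lemma ennpow_le_iff:
  assumes "0 < a" shows "ennpow x a \<le> ennpow y a \<longleftrightarrow> x \<le> y"
proof (cases x; cases y)
  fix r s :: real assume "0 \<le> r" "0 \<le> s" "x = ennreal r" "y = ennreal s"
  then show ?thesis
    using assms powr_less_mono2[of a s r] powr_mono2[of a r s]
    by (cases "r \<le> s") (auto simp: ennpow_ennreal not_le[symmetric])
qed (auto simp: ennpow_ennreal top_unique)

lemma ennpow_measurable [measurable]:
  assumes [measurable]: "f \<in> borel_measurable M"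
  shows "(\<lambda>x. ennpow (f x) a) \<in> borel_measurable M"
  unfolding ennpow_def by measurable

section \<open>Hoelder's inequality and its sharpness\<close>

text \<open>Young's inequality for two finite values; an infinite value makes the right side
  \<open>top\<close>, both coefficients being positive.\<close>

lemma ennpow_mult_ennpow_le:
  assumes "0 < \<theta>" "\<theta> < 1"
  shows "ennpow x \<theta> * ennpow y (1 - \<theta>) \<le> ennreal \<theta> * x + ennreal (1 - \<theta>) * y"
proof (cases x; cases y)
  fix r s :: real assume "0 \<le> r" "0 \<le> s" "x = ennreal r" "y = ennreal s"
  with assms show ?thesis
    using Youngs_inequality_0[of \<theta> "1 - \<theta>" r s]
    \<comment> \<open>\<open>Youngs_inequality_0\<close> covers positive reals; a zero factor makes
      the left side 0.\<close>
    by (cases "r = 0 \<or> s = 0")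
       (auto simp: ennpow_ennreal ennreal_mult[symmetric] ennreal_plus[symmetric] ennreal_leI simp del: ennreal_plus)
qed (use assms in \<open>auto simp: ennreal_mult_top\<close>)

text \<open>After division by their integrals both functions have integral 1, and integrating the
  pointwise Young inequality bounds the left side by \<theta> + (1 - \<theta>) = 1. Putting the
  exponents on \<open>f\<close> and \<open>g\<close> leaves a single parameter and no conjugate
  pair.\<close>

lemma nn_integral_Holder:
  assumes \<theta>: "0 < \<theta>" "\<theta> < 1"
    and [measurable]: "f \<in> borel_measurable M" "g \<in> borel_measurable M"
  shows "(\<integral>\<^sup>+x. ennpow (f x) \<theta> * ennpow (g x) (1 - \<theta>) \<partial>M)
    \<le> ennpow (\<integral>\<^sup>+x. f x \<partial>M) \<theta> * ennpow (\<integral>\<^sup>+x. g x \<partial>M) (1 - \<theta>)"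
    (is "?L \<le> ennpow ?a \<theta> * ennpow ?b (1 - \<theta>)")
proof -
  \<comment> \<open>A zero integral takes precedence over an infinite one: if both occur, the right
    side is \<open>0 * top = 0\<close>, and the integrand does vanish a.e.\<close>
  consider "?a = 0 \<or> ?b = 0" | "?a \<noteq> 0" "?b \<noteq> 0" "?a = top \<or> ?b = top"
    | "?a \<noteq> 0" "?b \<noteq> 0" "?a \<noteq> top" "?b \<noteq> top" by blast
  then show ?thesis
  proof cases
    case 1
    then have "AE x in M. f x = 0 \<or> g x = 0"
      by (auto simp: nn_integral_0_iff_AE elim: eventually_mono)
    then have "AE x in M. ennpow (f x) \<theta> * ennpow (g x) (1 - \<theta>) = 0"
      by eventually_elim auto
    then have "?L = 0"
      by (subst nn_integral_0_iff_AE) auto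
    then show ?thesis by simp
  next
    case 2
    then show ?thesis by (auto simp: ennreal_top_mult ennreal_mult_top)
  next
    case 3
    let ?k = "ennpow ?a \<theta> * ennpow ?b (1 - \<theta>)"
    have split: "ennpow x a = ennpow c a * ennpow (x / c) a" if "c \<noteq> 0" "c \<noteq> top" for x c a
      using that by (simp add: ennpow_mult[symmetric] ennreal_times_divide mult.commute[of c] ennreal_mult_divide_eq)
    have "?L = (\<integral>\<^sup>+x. ?k * (ennpow (f x / ?a) \<theta> * ennpow (g x / ?b) (1 - \<theta>)) \<partial>M)"
    proof (intro nn_integral_cong)
      fix x
      show "ennpow (f x) \<theta> * ennpow (g x) (1 - \<theta>)
          = ?k * (ennpow (f x / ?a) \<theta> * ennpow (g x / ?b) (1 - \<theta>))"
        using split[OF 3(1,3), of "f x" \<theta>] split[OF 3(2,4), of "g x" "1 - \<theta>"] by (simp only: ac_simps)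
    qed
    also have "\<dots> = ?k * (\<integral>\<^sup>+x. ennpow (f x / ?a) \<theta> * ennpow (g x / ?b) (1 - \<theta>) \<partial>M)"
      by (simp add: nn_integral_cmult)
    also have "\<dots> \<le> ?k * (\<integral>\<^sup>+x. ennreal \<theta> * (f x / ?a) + ennreal (1 - \<theta>) * (g x / ?b) \<partial>M)"
      by (intro mult_left_mono nn_integral_mono ennpow_mult_ennpow_le \<theta>) auto
    also have "(\<integral>\<^sup>+x. ennreal \<theta> * (f x / ?a) + ennreal (1 - \<theta>) * (g x / ?b) \<partial>M)
        = ennreal \<theta> * (?a / ?a) + ennreal (1 - \<theta>) * (?b / ?b)"
      by (simp add: nn_integral_add nn_integral_cmult nn_integral_divide)
    also have "\<dots> = 1"
      using 3 \<theta> by (simp add: ennreal_plus[symmetric] less_top del: ennreal_plus)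
    finally show ?thesis by simp
  qed
qed

text \<open>On a part of {f > k} of finite measure the positive function f - k has integral 0, so
  this part is null; countably many such parts cover {f > k}. This turns a bound on integrals into
  one on the essential supremum.\<close>

lemma (in sigma_finite_measure) AE_le_const_of_set_nn_integral_le:
  fixes f :: "'a \<Rightarrow> ennreal"
  assumes [measurable]: "f \<in> borel_measurable M" and "k < top"
    and le: "\<And>A. A \<in> sets M \<Longrightarrow> emeasure M A < top \<Longrightarrow>
      (\<integral>\<^sup>+x. f x * indicator A x \<partial>M) \<le> k * emeasure M A"
  shows "AE x in M. f x \<le> k"
proof -
  obtain F :: "nat \<Rightarrow> 'a set" where F: "range F \<subseteq> sets M" "(\<Union>i. F i) = space M"
      "\<And>i. emeasure M (F i) \<noteq> \<infinity>"
    using sigma_finite by metis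
  have [measurable]: "F i \<in> sets M" for i using F(1) by auto
  define E where "E i = {x \<in> F i. k < f x}" for i
  have E_eq: "E i = F i \<inter> {x \<in> space M. k < f x}" for i
    using sets.sets_into_space[of "F i" M] by (auto simp: E_def)
  have [measurable]: "E i \<in> sets M" for i unfolding E_eq by measurable
  have fin: "emeasure M (E i) < top" for i
    using emeasure_mono[of "E i" "F i" M] F(3)[of i] by (auto simp: E_def less_top order_le_less_trans)
  have "AE x in M. x \<notin> E i" for i
  proof -
    \<comment> \<open>Integrals may be subtracted here because \<open>k\<close> times the measure of
      \<open>E i\<close> is finite.\<close>
    have "(\<integral>\<^sup>+x. f x * indicator (E i) x - k * indicator (E i) x \<partial>M)
        = (\<integral>\<^sup>+x. f x * indicator (E i) x \<partial>M) - (\<integral>\<^sup>+x. k * indicator (E i) x \<partial>M)"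
      using fin[of i] \<open>k < top\<close>
      by (intro nn_integral_diff)
         (auto simp: nn_integral_cmult_indicator ennreal_mult_eq_top_iff E_def split: split_indicator)
    also have "\<dots> = 0"
      using le[OF _ fin[of i]] fin[of i] \<open>k < top\<close>
      by (simp add: nn_integral_cmult_indicator diff_eq_0_iff_ennreal ennreal_mult_less_top le_less_trans)
    finally have "AE x in M. f x * indicator (E i) x - k * indicator (E i) x = 0"
      by (subst (asm) nn_integral_0_iff_AE) auto
    then show ?thesis
    proof eventually_elim
      case (elim x)
      show ?case
      proof
        assume "x \<in> E i"
        with elim have "f x - k = 0" "k < f x" by (auto simp: E_def)
        then show False
          using \<open>k < top\<close> by (auto simp: diff_eq_0_iff_ennreal)
      qed
    qed
  qed
  then have "AE x in M. \<forall>i. x \<notin> E i" by (simp add: AE_all_countable)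
  then show ?thesis
  proof (rule AE_mp, intro AE_I2 impI)
    fix x assume "x \<in> space M" "\<forall>i. x \<notin> E i"
    with F(2) show "f x \<le> k" by (auto simp: E_def not_less)
  qed
qed

text \<open>Let I be the integral of h^r. Testing with g = h^(r/P), the equality case of Hoelder's
  inequality, gives I^(1/Q) \<le> c I^(1/P), hence I^(1/r) \<le> c. Truncation makes I finite, so
  that g is admissible and division is possible; monotone convergence removes it.\<close>

lemma (in sigma_finite_measure) nn_integral_Holder_converse:
  assumes Q: "0 < Q" "Q < P" and r: "1 / r = 1 / Q - 1 / P"
    and [measurable]: "h \<in> borel_measurable M" and fin: "AE x in M. h x < top"
    and bound: "\<And>g. g \<in> borel_measurable M \<Longrightarrow> (\<integral>\<^sup>+x. ennpow (g x) P \<partial>M) < top \<Longrightarrow>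
      ennpow (\<integral>\<^sup>+x. ennpow (g x * h x) Q \<partial>M) (1 / Q) \<le> c * ennpow (\<integral>\<^sup>+x. ennpow (g x) P \<partial>M) (1 / P)"
  shows "ennpow (\<integral>\<^sup>+x. ennpow (h x) r \<partial>M) (1 / r) \<le> c"
proof -
  have "0 < 1 / r" unfolding r using Q by (simp add: field_simps)
  then have r0: "0 < r" by simp
  \<comment> \<open>This identity gives (g h)^Q = h^r for the test function.\<close>
  have rQ: "r * Q / P + Q = r"
    using r Q r0 by (simp add: field_simps)
  obtain F :: "nat \<Rightarrow> 'a set" where F: "range F \<subseteq> sets M" "(\<Union>i. F i) = space M"
      "\<And>i. emeasure M (F i) \<noteq> \<infinity>" "incseq F"
    using sigma_finite_incseq by metis
  have [measurable]: "F i \<in> sets M" for i using F(1) by auto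
  \<comment> \<open>Finite measure and a bound on \<open>h\<close> together make the truncated
    integral finite.\<close>
  define E where "E i = F i \<inter> {x \<in> space M. h x \<le> ennreal (real i)}" for i
  have [measurable]: "E i \<in> sets M" for i unfolding E_def by measurable
  have incE: "E i \<subseteq> E j" if "i \<le> j" for i j
    using that incseqD[OF F(4) that] by (auto simp: E_def intro: order_trans ennreal_leI)
  define I where "I i = (\<integral>\<^sup>+x. ennpow (h x) r * indicator (E i) x \<partial>M)" for i
  have I_fin: "I i < top" for i
  proof -
    have "I i \<le> (\<integral>\<^sup>+x. ennpow (ennreal (real i)) r * indicator (F i) x \<partial>M)"
      unfolding I_def
      by (intro nn_integral_mono) (auto simp: E_def ennpow_le_iff[OF r0] split: split_indicator)
    also have "\<dots> < top"
      using F(3)[of i]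
      by (auto simp: nn_integral_cmult_indicator ennreal_mult_eq_top_iff less_top[symmetric])
    finally show ?thesis .
  qed
  have I_le: "I i \<le> ennpow c r" for i
  proof (cases "I i = 0")
    case False
    define g where "g x = ennpow (h x) (r / P) * indicator (E i) x" for x
    have [measurable]: "g \<in> borel_measurable M" unfolding g_def by measurable
    have g1: "ennpow (g x) P = ennpow (h x) r * indicator (E i) x" for x
      using Q by (auto simp: g_def ennpow_ennpow split: split_indicator)
    have g2: "ennpow (g x * h x) Q = ennpow (h x) r * indicator (E i) x" for x
      using Q by (auto simp: g_def ennpow_ennpow ennpow_mult ennpow_add[symmetric] rQ split: split_indicator)
    have "ennpow (I i) (1 / Q) \<le> c * ennpow (I i) (1 / P)"
      using bound[of g] I_fin[of i] by (simp add: g1 g2 I_def)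
    \<comment> \<open>From 1/Q = 1/r + 1/P; the common factor with exponent 1/P is then
      cancelled.\<close>
    moreover have "ennpow (I i) (1 / Q) = ennpow (I i) (1 / r) * ennpow (I i) (1 / P)"
      by (simp add: ennpow_add[symmetric] r)
    moreover have "ennpow (I i) (1 / P) \<noteq> 0" "ennpow (I i) (1 / P) \<noteq> top"
      using False I_fin[of i] by auto
    ultimately have "ennpow (I i) (1 / r) \<le> c"
      by (metis ennreal_mult_le_mult_iff mult.commute)
    then show ?thesis
      using ennpow_le_iff[OF r0, of "ennpow (I i) (1 / r)" c] r0 by (simp add: ennpow_ennpow)
  qed simp
  have "(\<integral>\<^sup>+x. ennpow (h x) r \<partial>M) = (\<integral>\<^sup>+x. (SUP i. ennpow (h x) r * indicator (E i) x) \<partial>M)"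
  \<comment> \<open>A point where \<open>h\<close> is finite lies in some \<open>E i\<close>, and
    there the supremum is attained; the remaining points form a null set.\<close>
  proof (rule nn_integral_cong_AE, use fin in \<open>rule AE_mp\<close>, intro AE_I2 impI)
    fix x assume x: "x \<in> space M" "h x < top"
    obtain i where i: "x \<in> F i" using F(2) x by auto
    obtain j :: nat where j: "h x \<le> ennreal (real j)"
      using x(2) by (cases "h x") (auto intro: ennreal_leI real_nat_ceiling_ge)
    have "x \<in> F (max i j)" using incseqD[OF F(4), of i "max i j"] i by auto
    moreover have "h x \<le> ennreal (real (max i j))"
      using j by (rule order_trans) (simp add: ennreal_leI)
    ultimately have "x \<in> E (max i j)"
      using x by (auto simp: E_def)
    then show "ennpow (h x) r = (SUP i. ennpow (h x) r * indicator (E i) x)"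
      by (intro antisym SUP_least SUP_upper2[of "max i j"]) (auto split: split_indicator)
  qed
  also have "\<dots> = (SUP i. I i)"
    unfolding I_def using incE
    by (intro nn_integral_monotone_convergence_SUP)
       (auto simp: incseq_def le_fun_def split: split_indicator)
  also have "\<dots> \<le> ennpow c r"
    by (intro SUP_least I_le)
  finally have "ennpow (\<integral>\<^sup>+x. ennpow (h x) r \<partial>M) (1 / r) \<le> ennpow (ennpow c r) (1 / r)"
    using r0 by (subst ennpow_le_iff) auto
  then show ?thesis using r0 by (simp add: ennpow_ennpow)
qed

section \<open>Tonelli's theorem on the triangle 0 < t < x\<close>

text \<open>A countable Borel cover by sets of finite measure serves for the completion as well, and
  restriction to a measurable set preserves sigma-finiteness.\<close>

lemma sigma_finite_lebesgue_on:
  fixes S :: "'a::euclidean_space set"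
  assumes "S \<in> sets lebesgue"
  shows "sigma_finite_measure (lebesgue_on S)"
proof (rule sigma_finite_measure_restrict_space[OF _ assms])
  obtain A :: "'a set set" where "countable A" "A \<subseteq> sets lborel" "\<Union>A = space lborel"
      "\<forall>a\<in>A. emeasure lborel a \<noteq> \<infinity>"
    using lborel.sigma_finite_countable by metis
  then show "sigma_finite_measure (lebesgue :: 'a measure)"
    by (intro sigma_finite_measure.intro exI[of _ A]) auto
qed

lemma nn_integral_lebesgue_on_subset:
  assumes "A \<subseteq> B" "A \<in> sets lebesgue" "B \<in> sets lebesgue"
  shows "(\<integral>\<^sup>+x. F x \<partial>lebesgue_on A) = (\<integral>\<^sup>+x. F x * indicator A x \<partial>lebesgue_on B)"
  using assms
  by (auto simp: nn_integral_restrict_space intro!: nn_integral_cong split: split_indicator)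

text \<open>Lets \<open>measurable\<close> handle the condition \<open>t < x\<close> on the product
  space.\<close>

lemma borel_measurable_lebesgue_on_ident [measurable]: "(\<lambda>x. x) \<in> borel_measurable (lebesgue_on S)"
  by (intro measurable_restrict_space1 measurable_completion) simp

text \<open>Writing the variable limits as the condition \<open>t < x\<close> under integrals over
  (0,\<infinity>) puts both sides in the form of an iterated integral of F(x) G(t) over the
  triangle.\<close>

lemma
  fixes F G :: "real \<Rightarrow> ennreal"
  assumes [measurable]: "F \<in> borel_measurable (lebesgue_on {0<..})" "G \<in> borel_measurable (lebesgue_on {0<..})"
  shows nn_integral_triangle_swap:
      "(\<integral>\<^sup>+t. (\<integral>\<^sup>+x. F x \<partial>lebesgue_on {t<..}) * G t \<partial>lebesgue_on {0<..})
       = (\<integral>\<^sup>+x. F x * (\<integral>\<^sup>+t. G t \<partial>lebesgue_on {0<..<x}) \<partial>lebesgue_on {0<..})"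
    and borel_measurable_nn_integral_upto [measurable]:
      "(\<lambda>x. \<integral>\<^sup>+t. F t \<partial>lebesgue_on {0<..<x}) \<in> borel_measurable (lebesgue_on {0<..})"
    and borel_measurable_nn_integral_from [measurable]:
      "(\<lambda>t. \<integral>\<^sup>+x. F x \<partial>lebesgue_on {t<..}) \<in> borel_measurable (lebesgue_on {0<..})"
proof -
  let ?M = "lebesgue_on {0::real<..}"
  interpret M: sigma_finite_measure ?M by (rule sigma_finite_lebesgue_on) simp
  interpret MM: pair_sigma_finite ?M ?M ..
  \<comment> \<open>Here \<open>t\<close> must be positive for (t,\<infinity>) to lie in
    (0,\<infinity>), whereas (0,x) lies in it for every real \<open>x\<close>.\<close>
  have up: "(\<integral>\<^sup>+x. F x \<partial>lebesgue_on {t<..}) = (\<integral>\<^sup>+x. (if t < x then F x else 0) \<partial>?M)" if "t \<in> space ?M" for F t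
    using that by (subst nn_integral_lebesgue_on_subset[of _ "{0<..}"]) (auto intro!: nn_integral_cong)
  have lo: "(\<integral>\<^sup>+t. G t \<partial>lebesgue_on {0<..<x}) = (\<integral>\<^sup>+t. (if t < x then G t else 0) \<partial>?M)" for G x
    by (subst nn_integral_lebesgue_on_subset[of _ "{0<..}"])
       (auto intro!: nn_integral_cong split: split_indicator)
  show "(\<lambda>x. \<integral>\<^sup>+t. F t \<partial>lebesgue_on {0<..<x}) \<in> borel_measurable ?M"
    unfolding lo by measurable
  show "(\<lambda>t. \<integral>\<^sup>+x. F x \<partial>lebesgue_on {t<..}) \<in> borel_measurable ?M"
    by (subst measurable_cong[OF up]) measurable
  have "(\<integral>\<^sup>+t. (\<integral>\<^sup>+x. F x \<partial>lebesgue_on {t<..}) * G t \<partial>?M)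
      = (\<integral>\<^sup>+t. (\<integral>\<^sup>+x. (if t < x then F x * G t else 0) \<partial>?M) \<partial>?M)"
    by (intro nn_integral_cong)
       (auto simp: up nn_integral_multc[symmetric] if_distrib[of "\<lambda>a. a * _"] cong: if_cong)
  also have "\<dots> = (\<integral>\<^sup>+x. (\<integral>\<^sup>+t. (if t < x then F x * G t else 0) \<partial>?M) \<partial>?M)"
    by (intro MM.Fubini') measurable
  also have "\<dots> = (\<integral>\<^sup>+x. F x * (\<integral>\<^sup>+t. G t \<partial>lebesgue_on {0<..<x}) \<partial>?M)"
    by (intro nn_integral_cong)
       (auto simp: lo nn_integral_cmult[symmetric] if_distrib[of "\<lambda>a. _ * a"] cong: if_cong)
  finally show "(\<integral>\<^sup>+t. (\<integral>\<^sup>+x. F x \<partial>lebesgue_on {t<..}) * G t \<partial>?M)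
      = (\<integral>\<^sup>+x. F x * (\<integral>\<^sup>+t. G t \<partial>lebesgue_on {0<..<x}) \<partial>?M)" .
qed

section \<open>Copson and Cesaro norms as weighted Lebesgue norms\<close>

lemma Lnorm_ennreal:
  "0 < P \<Longrightarrow> Lnorm (ennreal P) A f = ennpow (\<integral>\<^sup>+x. ennpow (f x) P \<partial>lebesgue_on A) (1 / P)"
  by (simp add: Lnorm_def)

lemma Lnorm_cong:
  assumes "\<And>x. x \<in> A \<Longrightarrow> f x = g x"
  shows "Lnorm p A f = Lnorm p A g"
proof -
  \<comment> \<open>\<open>esssup\<close> is defined by cases on measurability, so this has to be
    transferred first.\<close>
  have "f \<in> borel_measurable (lebesgue_on A) \<longleftrightarrow> g \<in> borel_measurable (lebesgue_on A)"
    using assms by (intro measurable_cong) simp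
  then have "esssup (lebesgue_on A) f = esssup (lebesgue_on A) g"
    using assms by (auto simp: esssup_def intro!: Limsup_eq)
  moreover have "(\<integral>\<^sup>+x. ennpow (f x) a \<partial>lebesgue_on A) = (\<integral>\<^sup>+x. ennpow (g x) a \<partial>lebesgue_on A)" for a
    using assms by (intro nn_integral_cong) simp
  ultimately show ?thesis by (simp add: Lnorm_def)
qed

lemma exp_to_ennreal:
  assumes "0 < Q" "Q < P"
  shows "exp_to (ennreal P) (ennreal Q) = ennreal (inverse (1 / Q - 1 / P))"
  using assms
  by (simp add: exp_to_def ennreal_lessI inverse_ennreal ennreal_minus field_simps)

text \<open>With equal exponents the outer power \<open>P\<close> cancels the inner root, and the
  triangle swap collects the integral of u^P over (0,x) as a factor of (f v)^P.\<close>

lemma Cop_norm_eq_wLnorm: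
  assumes "0 < P" "f \<in> Mplus" "v \<in> Mplus" "u \<in> Mplus"
  shows "Cop_norm (ennreal P) (ennreal P) u v f
    = wLnorm (ennreal P) (\<lambda>x. v x * Lnorm (ennreal P) {0<..<x} u) {0<..} f"
proof -
  have [measurable]: "f \<in> borel_measurable (lebesgue_on {0<..})"
      "v \<in> borel_measurable (lebesgue_on {0<..})" "u \<in> borel_measurable (lebesgue_on {0<..})"
    using assms by (simp_all add: Mplus_def)
  show ?thesis
    using \<open>0 < P\<close> nn_integral_triangle_swap[of "\<lambda>x. ennpow (f x * v x) P" "\<lambda>t. ennpow (u t) P"]
    by (simp add: Cop_norm_def wLnorm_def Lnorm_ennreal ennpow_mult ennpow_ennpow mult.assoc)
qed

text \<open>The triangle swap read from right to left, with u^P as \<open>F\<close> and (f v)^P as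
  \<open>G\<close>.\<close>

lemma Ces_norm_eq_wLnorm:
  assumes "0 < P" "f \<in> Mplus" "v \<in> Mplus" "u \<in> Mplus"
  shows "Ces_norm (ennreal P) (ennreal P) u v f
    = wLnorm (ennreal P) (\<lambda>x. v x * Lnorm (ennreal P) {x<..} u) {0<..} f"
proof -
  have [measurable]: "f \<in> borel_measurable (lebesgue_on {0<..})"
      "v \<in> borel_measurable (lebesgue_on {0<..})" "u \<in> borel_measurable (lebesgue_on {0<..})"
    using assms by (simp_all add: Mplus_def)
  show ?thesis
    using \<open>0 < P\<close> nn_integral_triangle_swap[of "\<lambda>t. ennpow (u t) P" "\<lambda>x. ennpow (f x * v x) P"]
    by (simp add: Ces_norm_def wLnorm_def Lnorm_ennreal ennpow_mult ennpow_ennpow ac_simps)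
qed

section \<open>The best constant between weighted Lebesgue spaces\<close>

text \<open>Since f w2 = (f w1) h a.e. for the quotient h = w2/w1, Hoelder's inequality shows that
  the norm of h is admissible. Conversely, f = g/w1 turns any admissible constant into a bound for
  multiplication by h, and sharpness applies.\<close>

lemma embedding_const_weighted_Lp:
  assumes PQ: "0 < Q" "Q \<le> P" and w: "w1 \<in> weights" "w2 \<in> weights"
  shows "embedding_const (wLnorm (ennreal P) w1 {0<..}) (wLnorm (ennreal Q) w2 {0<..})
    = Lnorm (exp_to (ennreal P) (ennreal Q)) {0<..} (\<lambda>x. inverse (w1 x) * w2 x)"
    (is "embedding_const ?N1 ?N2 = Lnorm _ _ ?h")
proof -
  let ?M = "lebesgue_on {0::real<..}"
  let ?B = "Lnorm (exp_to (ennreal P) (ennreal Q)) {0<..} ?h"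
  interpret sigma_finite_measure ?M by (rule sigma_finite_lebesgue_on) simp
  have [measurable]: "w1 \<in> borel_measurable ?M" "w2 \<in> borel_measurable ?M"
    and pos1: "AE x in ?M. 0 < w1 x \<and> w1 x < top" and pos2: "AE x in ?M. 0 < w2 x \<and> w2 x < top"
    using w by (auto simp: weights_def Mplus_def)
  have P0: "0 < P" using PQ by simp
  have N1: "?N1 f = ennpow (\<integral>\<^sup>+x. ennpow (f x * w1 x) P \<partial>?M) (1 / P)"
    and N2: "?N2 f = ennpow (\<integral>\<^sup>+x. ennpow (f x * w2 x) Q \<partial>?M) (1 / Q)" for f
    using PQ by (simp_all add: wLnorm_def Lnorm_ennreal)
  have cancel: "a * inverse b * b = a" if "0 < b" "b < top" for a b :: ennreal
    using that mult_divide_eq_ennreal[of b a]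
    by (simp add: divide_ennreal_def mult.assoc mult.commute mult.left_commute)

  have upper: "?N2 f \<le> ?B * ?N1 f" if "f \<in> Mplus" for f
  proof -
    have [measurable]: "f \<in> borel_measurable ?M" using that by (simp add: Mplus_def)
    have N2': "?N2 f = ennpow (\<integral>\<^sup>+x. ennpow (f x * w1 x * ?h x) Q \<partial>?M) (1 / Q)"
      unfolding N2 using pos1
      by (intro arg_cong2[where f = ennpow] refl nn_integral_cong_AE, eventually_elim)
         (metis cancel mult.assoc mult.commute)
    show ?thesis
    proof (cases "Q = P")
      case True
      then have B: "?B = esssup ?M ?h"
        by (simp add: exp_to_def Lnorm_def)
      have "AE x in ?M. ?h x \<le> ?B"
        unfolding B by (rule esssup_AE)
      then have "(\<integral>\<^sup>+x. ennpow (f x * w1 x * ?h x) P \<partial>?M)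
          \<le> (\<integral>\<^sup>+x. ennpow ?B P * ennpow (f x * w1 x) P \<partial>?M)"
        by (intro nn_integral_mono_AE, eventually_elim)
           (auto simp: ennpow_mult[symmetric] ennpow_le_iff[OF P0] mult.commute[of ?B] intro!: mult_left_mono)
      also have "\<dots> = ennpow ?B P * (\<integral>\<^sup>+x. ennpow (f x * w1 x) P \<partial>?M)"
        by (simp add: nn_integral_cmult)
      finally have "?N2 f \<le> ennpow (ennpow ?B P * (\<integral>\<^sup>+x. ennpow (f x * w1 x) P \<partial>?M)) (1 / P)"
        unfolding True N2'[unfolded True] using P0 by (subst ennpow_le_iff) auto
      then show ?thesis
        using P0 by (simp add: N1 ennpow_mult ennpow_ennpow)
    next
      case False
      with PQ have "Q < P" by simp
      define r where "r = inverse (1 / Q - 1 / P)"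
      have r: "1 / r = 1 / Q - 1 / P" by (simp add: r_def inverse_eq_divide)
      have "0 < 1 / r" unfolding r using \<open>Q < P\<close> PQ by (simp add: field_simps)
      then have r0: "0 < r" by simp
      \<comment> \<open>These say that 1 - Q/P = Q/r, so Hoelder's inequality with \<theta> = Q/P
        splits the Q-th power into a P-th power of f w1 and an r-th power of
        \<open>?h\<close>.\<close>
      have e: "r * (1 - Q / P) = Q" "(1 - Q / P) * (1 / Q) = 1 / r"
        using r r0 PQ P0 by (simp_all add: field_simps)
      have B: "?B = ennpow (\<integral>\<^sup>+x. ennpow (?h x) r \<partial>?M) (1 / r)"
        using \<open>Q < P\<close> PQ r0 by (simp add: exp_to_ennreal r_def[symmetric] Lnorm_ennreal)
      have "(\<integral>\<^sup>+x. ennpow (f x * w1 x * ?h x) Q \<partial>?M)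
          = (\<integral>\<^sup>+x. ennpow (ennpow (f x * w1 x) P) (Q / P) * ennpow (ennpow (?h x) r) (1 - Q / P) \<partial>?M)"
        unfolding ennpow_ennpow e using P0 by (simp add: ennpow_mult)
      also have "\<dots> \<le> ennpow (\<integral>\<^sup>+x. ennpow (f x * w1 x) P \<partial>?M) (Q / P)
          * ennpow (\<integral>\<^sup>+x. ennpow (?h x) r \<partial>?M) (1 - Q / P)"
        using \<open>Q < P\<close> PQ by (intro nn_integral_Holder) auto
      finally have "?N2 f \<le> ennpow (ennpow (\<integral>\<^sup>+x. ennpow (f x * w1 x) P \<partial>?M) (Q / P)
          * ennpow (\<integral>\<^sup>+x. ennpow (?h x) r \<partial>?M) (1 - Q / P)) (1 / Q)"
        unfolding N2' using PQ by (subst ennpow_le_iff) auto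
      then show ?thesis
        unfolding ennpow_mult ennpow_ennpow e B N1 using PQ by (simp add: mult.commute)
    qed
  qed

  have lower: "?B \<le> c" if c: "\<And>f. f \<in> space_of ?N1 \<Longrightarrow> ?N2 f \<le> c * ?N1 f" for c
  proof (cases "c = top")
    case False
    then have "c < top" by (simp add: less_top)
    have bound: "ennpow (\<integral>\<^sup>+x. ennpow (g x * ?h x) Q \<partial>?M) (1 / Q)
        \<le> c * ennpow (\<integral>\<^sup>+x. ennpow (g x) P \<partial>?M) (1 / P)"
      if [measurable]: "g \<in> borel_measurable ?M" and fin: "(\<integral>\<^sup>+x. ennpow (g x) P \<partial>?M) < top" for g
    proof -
      \<comment> \<open>Dividing by \<open>w1\<close> preserves the norm: cancellation holds
        wherever \<open>w1\<close> is positive and finite, hence a.e.\<close>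
      let ?f = "\<lambda>x. g x * inverse (w1 x)"
      have eq: "?N1 ?f = ennpow (\<integral>\<^sup>+x. ennpow (g x) P \<partial>?M) (1 / P)"
        unfolding N1 using pos1
        by (intro arg_cong2[where f = ennpow] refl nn_integral_cong_AE, eventually_elim) (simp add: cancel)
      then have "?f \<in> space_of ?N1"
        using fin by (simp add: space_of_def Mplus_def less_top[symmetric])
      from c[OF this] show ?thesis
        unfolding eq by (simp add: N2 mult.assoc)
    qed
    show ?thesis
    proof (cases "Q = P")
      case True
      \<comment> \<open>Indicators of sets of finite measure are the test functions when
        \<open>Q = P\<close>.\<close>
      have "AE x in ?M. ennpow (?h x) P \<le> ennpow c P"
      proof (rule AE_le_const_of_set_nn_integral_le)
        fix A assume A: "A \<in> sets ?M" "emeasure ?M A < top"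
        have ind: "ennpow (indicator A x) P = (indicator A x :: ennreal)" for x
          by (simp split: split_indicator)
        have "ennpow (\<integral>\<^sup>+x. ennpow (?h x) P * indicator A x \<partial>?M) (1 / P) \<le> c * ennpow (emeasure ?M A) (1 / P)"
          using bound[of "indicator A"] A by (simp add: True ind ennpow_mult ac_simps)
        then have "ennpow (ennpow (\<integral>\<^sup>+x. ennpow (?h x) P * indicator A x \<partial>?M) (1 / P)) P
            \<le> ennpow (c * ennpow (emeasure ?M A) (1 / P)) P"
          using P0 by (simp only: ennpow_le_iff)
        then show "(\<integral>\<^sup>+x. ennpow (?h x) P * indicator A x \<partial>?M) \<le> ennpow c P * emeasure ?M A"
          using P0 by (simp add: ennpow_mult ennpow_ennpow)
      qed (use \<open>c < top\<close> in \<open>auto simp: less_top[symmetric]\<close>)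
      then have "AE x in ?M. ?h x \<le> c"
        by (simp add: ennpow_le_iff[OF P0])
      then show ?thesis
        using True by (simp add: exp_to_def Lnorm_def esssup_I)
    next
      case False
      with PQ have "Q < P" by simp
      define r where "r = inverse (1 / Q - 1 / P)"
      have r: "1 / r = 1 / Q - 1 / P" by (simp add: r_def inverse_eq_divide)
      have "0 < 1 / r" unfolding r using \<open>Q < P\<close> PQ by (simp add: field_simps)
      then have r0: "0 < r" by simp
      \<comment> \<open>Positivity of \<open>w1\<close> and finiteness of \<open>w2\<close> a.e.
        exclude infinite values of the quotient.\<close>
      have fin: "AE x in ?M. ?h x < top"
        using pos1 pos2
      proof eventually_elim
        case (elim x)
        then have "inverse (w1 x) < top" by (auto simp: less_top[symmetric])
        with elim show ?case by (simp add: ennreal_mult_less_top)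
      qed
      have "ennpow (\<integral>\<^sup>+x. ennpow (?h x) r \<partial>?M) (1 / r) \<le> c"
        by (rule nn_integral_Holder_converse[OF PQ(1) \<open>Q < P\<close> r _ fin bound]) measurable
      then show ?thesis
        using \<open>Q < P\<close> PQ r0 by (simp add: exp_to_ennreal r_def[symmetric] Lnorm_ennreal)
    qed
  qed simp

  show ?thesis
    unfolding embedding_const_def
  proof (rule antisym)
    show "Inf {c. \<forall>f\<in>space_of ?N1. ?N2 f \<le> c * ?N1 f} \<le> ?B"
      using upper by (intro Inf_lower) (auto simp: space_of_def)
    show "?B \<le> Inf {c. \<forall>f\<in>space_of ?N1. ?N2 f \<le> c * ?N1 f}"
      using lower by (intro Inf_greatest) auto
  qed
qed

section \<open>The Copson-Cesaro embedding\<close>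

lemma embedding_const_cong:
  assumes "\<And>f. f \<in> Mplus \<Longrightarrow> N1 f = N1' f" "\<And>f. f \<in> Mplus \<Longrightarrow> N2 f = N2' f"
  shows "embedding_const N1 N2 = embedding_const N1' N2'"
  unfolding embedding_const_def space_of_def
  using assms by (intro arg_cong[where f = Inf]) auto

text \<open>Applied with \<open>U\<close> the norm of \<open>u1\<close> over (0,x) or of
  \<open>u2\<close> over (x,\<infinity>), whose bounds come from \<open>cOmega\<close> and
  \<open>Omega\<close>.\<close>

lemma weights_mult:
  assumes "v \<in> weights" "U \<in> Mplus" "\<And>x. 0 < x \<Longrightarrow> 0 < U x \<and> U x < top"
  shows "(\<lambda>x. v x * U x) \<in> weights"
proof -
  have "AE x in lebesgue_on {0<..}. 0 < v x \<and> v x < top" using assms by (simp add: weights_def)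
  moreover have "AE x in lebesgue_on {0<..}. 0 < U x \<and> U x < top"
    using assms(3) by (intro AE_I2) auto
  ultimately have "AE x in lebesgue_on {0<..}. 0 < v x * U x \<and> v x * U x < top"
    by eventually_elim (simp add: ennreal_mult_less_top ennreal_zero_less_mult_iff)
  then show ?thesis
    using assms by (auto simp: weights_def Mplus_def)
qed

lemma embedding_const_Cop_Ces:
  assumes PQ: "0 < Q" "Q \<le> P" and v: "v1 \<in> weights" "v2 \<in> weights"
    and u1: "u1 \<in> cOmega (ennreal P)" and u2: "u2 \<in> Omega (ennreal Q)"
  shows "embedding_const (Cop_norm (ennreal P) (ennreal P) u1 v1) (Ces_norm (ennreal Q) (ennreal Q) u2 v2)
    = wLnorm (exp_to (ennreal P) (ennreal Q)) (\<lambda>x. inverse (v1 x) * v2 x) {0<..}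
        (\<lambda>t. inverse (Lnorm (ennreal P) {0<..<t} u1) * Lnorm (ennreal Q) {t<..} u2)"
proof -
  let ?U1 = "\<lambda>x. Lnorm (ennreal P) {0<..<x} u1" and ?U2 = "\<lambda>x. Lnorm (ennreal Q) {x<..} u2"
  have P0: "0 < P" using PQ by simp
  have [measurable]: "u1 \<in> borel_measurable (lebesgue_on {0<..})" "u2 \<in> borel_measurable (lebesgue_on {0<..})"
    using u1 u2 by (simp_all add: cOmega_def Omega_def Mplus_def)
  have U1: "0 < ?U1 x \<and> ?U1 x < top" and U2: "0 < ?U2 x \<and> ?U2 x < top" if "0 < x" for x
    using that u1 u2 by (simp_all add: cOmega_def Omega_def)
  have "embedding_const (Cop_norm (ennreal P) (ennreal P) u1 v1) (Ces_norm (ennreal Q) (ennreal Q) u2 v2)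
      = embedding_const (wLnorm (ennreal P) (\<lambda>x. v1 x * ?U1 x) {0<..}) (wLnorm (ennreal Q) (\<lambda>x. v2 x * ?U2 x) {0<..})"
    using PQ P0 v u1 u2
    by (intro embedding_const_cong Cop_norm_eq_wLnorm Ces_norm_eq_wLnorm)
       (auto simp: weights_def cOmega_def Omega_def)
  also have "\<dots> = Lnorm (exp_to (ennreal P) (ennreal Q)) {0<..} (\<lambda>x. inverse (v1 x * ?U1 x) * (v2 x * ?U2 x))"
  proof (intro embedding_const_weighted_Lp PQ weights_mult v)
    show "?U1 \<in> Mplus" "?U2 \<in> Mplus"
      using PQ P0 by (simp_all add: Lnorm_ennreal Mplus_def)
  qed (use U1 U2 in auto)
  also have "\<dots> = Lnorm (exp_to (ennreal P) (ennreal Q)) {0<..}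
      (\<lambda>x. inverse (?U1 x) * ?U2 x * (inverse (v1 x) * v2 x))"
    \<comment> \<open>The inverse of the product splits at every x > 0, even where \<open>v1\<close>
      is 0 or \<open>top\<close>, because the other factor is positive and finite. Hence pointwise
      congruence suffices.\<close>
    using U1 by (intro Lnorm_cong) (simp add: ennreal_inverse_mult' ac_simps)
  finally show ?thesis by (simp add: wLnorm_def)
qed

theorem theorem7p2:
  fixes p1 q1 p2 q2 :: ennreal
  assumes "0 < p1" "p1 = q1" "q1 < top"
    and "0 < p2" "p2 = q2" "q2 < top"
    and "p2 \<le> p1"
  shows "\<exists>c::real. c > 0 \<and>
    (\<forall>v1 \<in> weights. \<forall>v2 \<in> weights. \<forall>u1 \<in> cOmega q1. \<forall>u2 \<in> Omega q2.
      let v = (\<lambda>x. inverse (v1 x) * v2 x);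
          A = embedding_const (Cop_norm p1 q1 u1 v1) (Ces_norm p2 q2 u2 v2);
          B = wLnorm (exp_to p1 p2) v {0<..}
                (\<lambda>t. inverse (Lnorm p1 {0<..<t} u1) * Lnorm p2 {t<..} u2)
      in ennreal (inverse c) * B \<le> A \<and> A \<le> ennreal c * B)"
proof -
  obtain P Q where PQ: "p1 = ennreal P" "p2 = ennreal Q" "0 < Q" "Q \<le> P"
    using assms by (cases p1; cases p2) auto
  show ?thesis
    using PQ(3,4) assms(2,5) unfolding PQ(1,2)
    \<comment> \<open>The two quantities are equal, so the constant 1 serves for both
      inequalities.\<close>
    by (intro exI[of _ 1]) (auto simp: Let_def embedding_const_Cop_Ces)
qed

end
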